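(* Let $\theta\in\mathbb R\setminus\{0\}$ and $0<p<1$. Let $X_{\mathrm{bulk}}$, $X_{\mathrm{tail}}$ be real random variables with $\mathrm{P}(X_{\mathrm{tail}}=0)=0$, and for $w>0$ let $X=X^{(w)}$ be the random variable $$X=\begin{cases}X_{\mathrm{bulk}} & \text{with probability } p,\\ w X_{\mathrm{tail}} & \text{with probability } 1-p,\end{cases}$$ (that is, the law of $X$ is the mixture of the laws of $X_{\mathrm{bulk}}$ and $wX_{\mathrm{tail}}$ with weights $p$ and $1-p$), where $X\in\mathcal D$ for every $w>0$. Then $$l^\theta(X)\longrightarrow l^\theta(X_{\mathrm{bulk}})-\frac{2\ln p}{\theta^2}\qquad\text{as } w\to\infty .$$
   Context: $\mathcal D$ denotes the class of (one- or multi-dimensional) random variables with strictly positive-definite Lebesgue density, together with the limiting case of an atom at $0$ (the law is allowed to have a component $\delta_0$, including $X=0$). In particular, every $X\in\mathcal D$ has a symmetric law and a characteristic function $\varphi_X(\theta)=\mathbb E[e^{i\theta X}]$ that is real-valued and strictly positive. For a random variable $X$ with real characteristic function and $\theta\neq0$, the logarithm of characteristic function (lcf) is $l^\theta(X):=-\frac{2}{\theta^2}\ln\mathbb E[e^{i\theta X}]$, with the convention $l^\theta(X)=+\infty$ if $\mathbb E[e^{i\theta X}]=0$. *)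

theory Defs
  imports "HOL-Probability.Probability"
begin

(* The points are the elements of a finite set, hence pairwise distinct. With complex
   coefficients, the requirement that the quadratic form be real makes f even. *)
definition strictly_positive_definite :: "('a::real_vector \<Rightarrow> real) \<Rightarrow> bool" where
  "strictly_positive_definite f \<longleftrightarrow>
     (\<forall>(A :: 'a set) (c :: 'a \<Rightarrow> complex). finite A \<and> (\<exists>x\<in>A. c x \<noteq> 0) \<longrightarrow>
        (\<Sum>x\<in>A. \<Sum>y\<in>A. c x * cnj (c y) * of_real (f (x - y))) \<in> \<real> \<and>
        0 < Re (\<Sum>x\<in>A. \<Sum>y\<in>A. c x * cnj (c y) * of_real (f (x - y))))"

(* The law of X is a * delta_0 + (1 - a) * f dx; a = 0 is the purely absolutely continuous
   case and a = 1 is X = 0. Only some version of the density has to be strictly positive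
   definite. *)
definition class_D :: "'b measure \<Rightarrow> ('b \<Rightarrow> 'a::euclidean_space) \<Rightarrow> bool" where
  "class_D M X \<longleftrightarrow> prob_space M \<and> X \<in> borel_measurable M \<and>
     (\<exists>(a :: real) (f :: 'a \<Rightarrow> real). 0 \<le> a \<and> a \<le> 1 \<and>
        f \<in> borel_measurable borel \<and> (\<forall>x. 0 \<le> f x) \<and>
        (\<integral>\<^sup>+x. ennreal (f x) \<partial>lborel) = 1 \<and>
        strictly_positive_definite f \<and>
        (\<forall>B\<in>sets borel. emeasure (distr M borel X) B =
            ennreal a * indicator B 0 + ennreal (1 - a) * emeasure (density lborel f) B))"

(* Meant for random variables whose characteristic function at theta is real and
   nonnegative; Re is then only the passage from complex to real. *)
definition lcf :: "real \<Rightarrow> 'b measure \<Rightarrow> ('b \<Rightarrow> real) \<Rightarrow> ereal" where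
  "lcf \<theta> M X =
     (if char (distr M borel X) \<theta> = 0 then \<infinity>
      else ereal (- (2 / \<theta>\<^sup>2) * ln (Re (char (distr M borel X) \<theta>))))"

end

(* Write phi for the characteristic function. The mixture gives
   phi_X(theta) = p phi_bulk(theta) + (1 - p) phi_tail(theta w). Since the law of X is a
   combination of delta_0 and a density, and the tail has no atom at 0, the tail law is
   absolutely continuous, so phi_tail(theta w) -> 0 by the Riemann-Lebesgue lemma. Hence
   phi_X(theta) -> p phi_bulk(theta).

   To take logarithms one needs phi_X(theta) real and nonnegative, that is, the Fourier
   transform of an integrable strictly positive definite f must be nonnegative even when f is
   not continuous. Evaluating the quadratic form of f at n independent centred Gaussian points
   with coefficients exp(i theta x_j) and taking expectations gives
   n f(0) + n (n - 1) J >= 0, where J is the integral of f(u) cos(theta u) against a Gaussian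
   density; thus J >= 0, and letting the variance tend to infinity gives the claim. *)
theory Submission
  imports Defs
begin

subsection \<open>The Riemann-Lebesgue lemma\<close>

text \<open>Integrability is kept out of the predicate. Since the Bochner integral of a
  non-integrable function is 0, additivity has to carry integrability as separate premises.\<close>

definition fourier_vanishes :: "(real \<Rightarrow> complex) \<Rightarrow> bool" where
  "fourier_vanishes f \<longleftrightarrow> ((\<lambda>t. \<integral>x. f x * iexp (t * x) \<partial>lborel) \<longlongrightarrow> 0) at_infinity"

lemma integrable_mult_iexp:
  fixes f :: "real \<Rightarrow> complex"
  assumes "integrable lborel f"
  shows "integrable lborel (\<lambda>x. f x * iexp (t * x))"
  by (rule Bochner_Integration.integrable_bound[OF assms])
     (use assms in \<open>auto simp: norm_mult\<close>)

lemma integrable_complex_indicator: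
  assumes "A \<in> sets M" "emeasure M A < \<infinity>"
  shows "integrable M (indicator A :: 'a \<Rightarrow> complex)"
  using integrable_of_real[OF integrable_real_indicator[OF assms], where 'a=complex]
  by (simp add: of_real_indicator)

text \<open>Dominated convergence turns pointwise into L1 convergence, and the L1 norm bounds the
  Fourier transform uniformly in \<open>t\<close>. One fixed index \<open>i\<close> therefore serves
  all \<open>t\<close>, and two errors of size \<open>e / 2\<close> add up. Every passage to the
  limit in \<open>f\<close> below goes through this fact.\<close>

lemma fourier_vanishes_dominated:
  fixes f :: "real \<Rightarrow> complex"
  assumes s: "\<And>i. integrable lborel (s i)" "\<And>i. fourier_vanishes (s i)"
    and lim: "\<And>x. (\<lambda>i. s i x) \<longlonglongrightarrow> f x"
    and bound: "\<And>i x. norm (s i x) \<le> w x" and w: "integrable lborel w"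
  shows "fourier_vanishes f"
proof -
  have ms[measurable]: "s i \<in> borel_measurable borel" for i
    using s(1)[of i] by auto
  have mf[measurable]: "f \<in> borel_measurable borel"
    by (rule borel_measurable_LIMSEQ_metric[OF _ lim]) simp
  have mw[measurable]: "w \<in> borel_measurable borel"
    using w by auto
  have fw: "norm (f x) \<le> w x" for x
    by (rule Lim_bounded[OF tendsto_norm[OF lim], of 0]) (use bound in auto)
  have f: "integrable lborel f"
    by (rule Bochner_Integration.integrable_bound[OF w]) (auto intro: order_trans[OF fw abs_ge_self])
  have "(\<lambda>i. \<integral>x. norm (s i x - f x) \<partial>lborel) \<longlonglongrightarrow> (\<integral>x. 0 \<partial>(lborel::real measure))"
  proof (rule integral_dominated_convergence[where w="\<lambda>x. 2 * w x"])
    show "AE x in lborel. (\<lambda>i. norm (s i x - f x)) \<longlonglongrightarrow> 0"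
      using lim by (auto intro!: AE_I2 simp: LIM_zero tendsto_norm_zero_iff)
    have "norm (s i x - f x) \<le> 2 * w x" for i x
      using norm_triangle_ineq4[of "s i x" "f x"] bound[of i x] fw[of x] by linarith
    then show "AE x in lborel. norm (norm (s i x - f x)) \<le> 2 * w x" for i
      by (intro AE_I2) simp
  qed (use w in auto)
  then have L1: "(\<lambda>i. \<integral>x. norm (s i x - f x) \<partial>lborel) \<longlonglongrightarrow> 0" by simp
  show ?thesis
    unfolding fourier_vanishes_def
  proof (rule tendstoI)
    fix e :: real assume "0 < e"
    then have "eventually (\<lambda>i. (\<integral>x. norm (s i x - f x) \<partial>lborel) < e / 2) sequentially"
      using L1 by (intro order_tendstoD(2)[OF L1]) auto
    then obtain i where i: "(\<integral>x. norm (s i x - f x) \<partial>lborel) < e / 2"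
      by (auto simp: eventually_sequentially)
    have "eventually (\<lambda>t. dist (\<integral>x. s i x * iexp (t * x) \<partial>lborel) 0 < e / 2) at_infinity"
      using s(2)[of i, unfolded fourier_vanishes_def] \<open>0 < e\<close> by (intro tendstoD) auto
    then show "eventually (\<lambda>t. dist (\<integral>x. f x * iexp (t * x) \<partial>lborel) 0 < e) at_infinity"
    proof eventually_elim
      case (elim t)
      have "norm ((\<integral>x. s i x * iexp (t * x) \<partial>lborel) - (\<integral>x. f x * iexp (t * x) \<partial>lborel))
          = norm (\<integral>x. (s i x - f x) * iexp (t * x) \<partial>lborel)"
        using integrable_mult_iexp[OF s(1)[of i], of t] integrable_mult_iexp[OF f, of t]
        by (simp add: left_diff_distrib)
      also have "\<dots> \<le> (\<integral>x. norm ((s i x - f x) * iexp (t * x)) \<partial>lborel)"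
        by (rule integral_norm_bound)
      also have "\<dots> = (\<integral>x. norm (s i x - f x) \<partial>lborel)"
        by (simp add: norm_mult)
      finally have "norm ((\<integral>x. s i x * iexp (t * x) \<partial>lborel) - (\<integral>x. f x * iexp (t * x) \<partial>lborel)) < e / 2"
        using i by simp
      then show ?case
        using elim norm_triangle_ineq4[of "\<integral>x. s i x * iexp (t * x) \<partial>lborel"
          "(\<integral>x. s i x * iexp (t * x) \<partial>lborel) - (\<integral>x. f x * iexp (t * x) \<partial>lborel)"]
        by (simp add: dist_norm)
    qed
  qed
qed

lemma fourier_vanishes_zero: "fourier_vanishes (\<lambda>x. 0)"
  by (simp add: fourier_vanishes_def)

lemma fourier_vanishes_add:
  assumes "integrable lborel f" "fourier_vanishes f" "integrable lborel g" "fourier_vanishes g"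
  shows "fourier_vanishes (\<lambda>x. f x + g x)"
proof -
  have "(\<integral>x. (f x + g x) * iexp (t * x) \<partial>lborel) =
      (\<integral>x. f x * iexp (t * x) \<partial>lborel) + (\<integral>x. g x * iexp (t * x) \<partial>lborel)" for t
    using integrable_mult_iexp[OF assms(1), of t] integrable_mult_iexp[OF assms(3), of t]
    by (simp add: distrib_right)
  then show ?thesis
    using tendsto_add[OF assms(2,4)[unfolded fourier_vanishes_def]] by (simp add: fourier_vanishes_def)
qed

lemma fourier_vanishes_cmult:
  assumes "fourier_vanishes f"
  shows "fourier_vanishes (\<lambda>x. c * f x)"
  using tendsto_mult_left[OF assms[unfolded fourier_vanishes_def], of c]
  by (simp add: fourier_vanishes_def mult.assoc)

lemma fourier_vanishes_sum:
  assumes "\<And>i. i \<in> I \<Longrightarrow> integrable lborel (f i)" "\<And>i. i \<in> I \<Longrightarrow> fourier_vanishes (f i)"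
  shows "fourier_vanishes (\<lambda>x. \<Sum>i\<in>I. f i x)"
  using assms
proof (induction I rule: infinite_finite_induct)
  case (insert i I)
  then show ?case by (auto intro!: fourier_vanishes_add)
qed (auto simp: fourier_vanishes_zero)

text \<open>The antiderivative of \<open>iexp (t * x)\<close> is the same function divided by
  \<open>\<i> * t\<close>, so only two boundary terms remain and the transform is at most
  \<open>2 / norm t\<close>.\<close>

lemma fourier_vanishes_interval: "fourier_vanishes (indicator {a..b::real})"
proof (cases "a \<le> b")
  case True
  have eq: "(\<integral>x. indicator {a..b} x * iexp (t * x) \<partial>lborel) =
      (iexp (t * b) - iexp (t * a)) / (\<i> * t)" if "t \<noteq> 0" for t
  proof -
    have "((\<lambda>x. iexp (t * x) / (\<i> * t)) has_vector_derivative iexp (t * x)) (at x within {a..b})" for x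
    proof -
      have "((\<lambda>z. exp (\<i> * (t * z)) / (\<i> * t)) has_field_derivative exp (\<i> * (t * of_real x)))
          (at (of_real x))"
        using that by (auto intro!: derivative_eq_intros simp: field_simps)
      from has_vector_derivative_real_field[OF this] show ?thesis by simp
    qed
    then have "integral\<^sup>L lborel (\<lambda>x. indicator {a .. b} x *\<^sub>R iexp (t * x)) =
       iexp (t * b) / (\<i> * t) - iexp (t * a) / (\<i> * t)"
      using True by (intro integral_FTC_atLeastAtMost) (auto intro!: continuous_intros)
    moreover have "indicator {a..b} x * z = indicator {a..b} x *\<^sub>R (z::complex)" for x z
      by (auto split: split_indicator)
    ultimately show ?thesis by (simp add: diff_divide_distrib)
  qed
  have "((\<lambda>t::real. 2 / norm t) \<longlongrightarrow> 0) at_infinity"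
    by (intro tendsto_divide_0[OF tendsto_const] filterlim_at_top_imp_at_infinity filterlim_norm_at_top)
  moreover have "eventually (\<lambda>t::real. t \<noteq> 0) at_infinity"
    by (rule eventually_at_infinityI[of 1]) auto
  then have "eventually (\<lambda>t. norm (\<integral>x. indicator {a..b} x * iexp (t * x) \<partial>lborel) \<le> 2 / norm t) at_infinity"
  proof eventually_elim
    case (elim t)
    have "norm (iexp (t * b) - iexp (t * a)) \<le> 2"
      using norm_triangle_ineq4[of "iexp (t * b)" "iexp (t * a)"] by simp
    then show ?case
      unfolding eq[OF elim] norm_divide using elim by (simp add: norm_mult divide_right_mono)
  qed
  ultimately show ?thesis
    unfolding fourier_vanishes_def by (rule Lim_null_comparison[rotated])
qed (simp add: fourier_vanishes_def)

text \<open>The window \<open>{a..b}\<close> gives every set of the Borel induction finite measure.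
  Without it, complements would lead to indicators that are not integrable.\<close>

lemma fourier_vanishes_indicator_bounded:
  fixes A :: "real set"
  assumes "A \<in> sets borel"
  shows "fourier_vanishes (indicator (A \<inter> {a..b}))"
  using assms
proof (induction rule: borel_set_induct)
  case empty
  then show ?case by (simp add: fourier_vanishes_def)
next
  case (interval c d)
  then show ?case by (simp add: fourier_vanishes_interval)
next
  case (compl A)
  \<comment> \<open>Within the window, complementation is subtraction from the interval, hence a
    linear combination of functions already treated.\<close>
  have "indicator (- A \<inter> {a..b}) x = indicator {a..b} x + (- 1) * (indicator (A \<inter> {a..b}) x :: complex)" for x
    by (auto split: split_indicator)
  then have *: "(indicator (- A \<inter> {a..b}) :: real \<Rightarrow> complex) =
      (\<lambda>x. indicator {a..b} x + (- 1) * indicator (A \<inter> {a..b}) x)" by blast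
  have [measurable]: "A \<in> sets borel" by fact
  have "emeasure lborel (A \<inter> {a..b}) \<le> emeasure lborel {a..b}" by (rule emeasure_mono) auto
  also have "\<dots> < \<infinity>" by (cases "a \<le> b") auto
  finally have fin: "emeasure lborel (A \<inter> {a..b}) < \<infinity>" .
  show ?case
    unfolding *
    by (rule fourier_vanishes_add[OF _ fourier_vanishes_interval _ fourier_vanishes_cmult[OF compl.IH]])
       (use fin in \<open>auto intro!: integrable_complex_indicator simp: emeasure_lborel_Icc_eq\<close>)
next
  case (union A)
  have [measurable]: "A i \<in> sets borel" for i by (rule union)
  have fin: "emeasure lborel (A i \<inter> {a..b}) < \<infinity>" for i
  proof -
    have "emeasure lborel (A i \<inter> {a..b}) \<le> emeasure lborel {a..b}" by (rule emeasure_mono) auto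
    also have "\<dots> < \<infinity>" by (cases "a \<le> b") auto
    finally show ?thesis .
  qed
  have int: "integrable lborel (indicator (A i \<inter> {a..b}) :: real \<Rightarrow> complex)" for i
    using fin by (auto intro!: integrable_complex_indicator)
  have disj: "disjoint_family (\<lambda>i. A i \<inter> {a..b})"
    using union(1) by (auto simp: disjoint_family_on_def)
  \<comment> \<open>By disjointness the partial sums stay indicators, so the indicator of
    \<open>{a..b}\<close> dominates all of them.\<close>
  have part: "(\<Sum>i<n. indicator (A i \<inter> {a..b}) x) = (indicator (\<Union>i<n. A i \<inter> {a..b}) x :: complex)" for n x
    by (rule indicator_UN_disjoint[symmetric]) (use disj in \<open>auto simp: disjoint_family_on_def\<close>)
  show ?case
  proof (rule fourier_vanishes_dominated)
    show "integrable lborel (\<lambda>x. \<Sum>i<n. indicator (A i \<inter> {a..b}) x :: complex)" for n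
      using int by auto
    show "fourier_vanishes (\<lambda>x. \<Sum>i<n. indicator (A i \<inter> {a..b}) x)" for n
      by (rule fourier_vanishes_sum) (rule int, rule union.IH)
    show "(\<lambda>n. \<Sum>i<n. indicator (A i \<inter> {a..b}) x :: complex) \<longlonglongrightarrow> indicator ((\<Union>i. A i) \<inter> {a..b}) x" for x
    proof -
      have "(\<Union>i. A i) \<inter> {a..b} = (\<Union>i. A i \<inter> {a..b})" by auto
      then show ?thesis unfolding part by (simp only: LIMSEQ_indicator_UN)
    qed
    show "norm (\<Sum>i<n. indicator (A i \<inter> {a..b}) x :: complex) \<le> indicator {a..b} x" for n x
      unfolding part by (auto split: split_indicator)
    show "integrable lborel (indicator {a..b} :: real \<Rightarrow> real)"
      by (auto intro!: integrable_real_indicator simp: emeasure_lborel_Icc_eq)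
  qed
qed

text \<open>Induction over integrable functions leaves multiples of indicators of sets of finite
  measure, sums, and dominated limits. Such an indicator is itself the dominated limit of its
  truncations to \<open>{- real n..real n}\<close>.\<close>

lemma Riemann_Lebesgue:
  fixes f :: "real \<Rightarrow> complex"
  assumes "integrable lborel f"
  shows "((\<lambda>t. \<integral>x. f x * iexp (t * x) \<partial>lborel) \<longlongrightarrow> 0) at_infinity"
proof -
  have "fourier_vanishes f"
    using assms
  proof (induction rule: integrable_induct)
    case (base A c)
    then have [measurable]: "A \<in> sets borel" by simp
    have "fourier_vanishes (indicator A)"
    proof (rule fourier_vanishes_dominated)
      show "integrable lborel (indicator (A \<inter> {- real n..real n}) :: real \<Rightarrow> complex)" for n
      proof -
        have "emeasure lborel (A \<inter> {- real n..real n}) \<le> emeasure lborel A"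
          by (rule emeasure_mono) auto
        then show ?thesis using base(2) by (intro integrable_complex_indicator)
            (simp, rule le_less_trans)
      qed
      show "fourier_vanishes (indicator (A \<inter> {- real n..real n}))" for n
        by (rule fourier_vanishes_indicator_bounded) simp
      show "(\<lambda>n. indicator (A \<inter> {- real n..real n}) x :: complex) \<longlonglongrightarrow> indicator A x" for x
      proof (rule tendsto_eventually)
        obtain N where "\<bar>x\<bar> \<le> real N" using real_arch_simple by blast
        then show "eventually (\<lambda>n. (indicator (A \<inter> {- real n..real n}) x :: complex) = indicator A x) sequentially"
          by (intro eventually_sequentiallyI[of N]) (auto split: split_indicator)
      qed
      show "norm (indicator (A \<inter> {- real n..real n}) x :: complex) \<le> indicator A x" for n x
        by (auto split: split_indicator)
      show "integrable lborel (indicator A :: real \<Rightarrow> real)"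
        using base by (auto intro!: integrable_real_indicator)
    qed
    from fourier_vanishes_cmult[OF this, of c]
    show ?case by (simp add: scaleR_conv_of_real of_real_indicator mult.commute indicator_eq_0_iff)
  next
    case (add f g)
    then show ?case by (intro fourier_vanishes_add)
  next
    case (lim f s)
    \<comment> \<open>The factor 2 is the one in the bound on the approximants supplied by
      \<open>integrable_induct\<close>.\<close>
    show ?case
      by (rule fourier_vanishes_dominated[where s=s and w="\<lambda>x. 2 * norm (f x)"]) (use lim in auto)
  qed
  then show ?thesis by (simp add: fourier_vanishes_def)
qed

subsection \<open>Strictly positive definite functions\<close>

text \<open>The points need not be distinct: coefficients at coinciding points are added up.\<close>

lemma strictly_positive_definite_sum_nonneg:
  fixes x :: "'i \<Rightarrow> 'a::real_vector"
  assumes f: "strictly_positive_definite f" and I: "finite I"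
  shows "0 \<le> Re (\<Sum>i\<in>I. \<Sum>j\<in>I. d i * cnj (d j) * of_real (f (x i - x j)))"
proof -
  define c where "c y = (\<Sum>i\<in>{i\<in>I. x i = y}. d i)" for y
  have "(\<Sum>i\<in>I. \<Sum>j\<in>I. d i * cnj (d j) * of_real (f (x i - x j)))
      = (\<Sum>i\<in>I. d i * (\<Sum>z\<in>x ` I. cnj (c z) * of_real (f (x i - z))))"
  proof (rule sum.cong[OF refl])
    fix i
    have "(\<Sum>j\<in>I. d i * cnj (d j) * of_real (f (x i - x j))) =
        d i * (\<Sum>j\<in>I. cnj (d j) * of_real (f (x i - x j)))"
      by (simp add: sum_distrib_left mult.assoc)
    also have "(\<Sum>j\<in>I. cnj (d j) * of_real (f (x i - x j))) =
        (\<Sum>z\<in>x ` I. \<Sum>j\<in>{j\<in>I. x j = z}. cnj (d j) * of_real (f (x i - x j)))"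
      by (rule sum.image_gen[OF I])
    also have "\<dots> = (\<Sum>z\<in>x ` I. cnj (c z) * of_real (f (x i - z)))"
      by (auto intro!: sum.cong simp: c_def sum_distrib_right)
    finally show "(\<Sum>j\<in>I. d i * cnj (d j) * of_real (f (x i - x j))) =
        d i * (\<Sum>z\<in>x ` I. cnj (c z) * of_real (f (x i - z)))" .
  qed
  also have "\<dots> = (\<Sum>y\<in>x ` I. \<Sum>i\<in>{i\<in>I. x i = y}. d i * (\<Sum>z\<in>x ` I. cnj (c z) * of_real (f (x i - z))))"
    by (rule sum.image_gen[OF I])
  also have "\<dots> = (\<Sum>y\<in>x ` I. c y * (\<Sum>z\<in>x ` I. cnj (c z) * of_real (f (y - z))))"
    by (auto intro!: sum.cong simp: c_def sum_distrib_right)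
  also have "\<dots> = (\<Sum>y\<in>x ` I. \<Sum>z\<in>x ` I. c y * cnj (c z) * of_real (f (y - z)))"
    by (simp add: sum_distrib_left mult.assoc)
  finally have eq: "(\<Sum>i\<in>I. \<Sum>j\<in>I. d i * cnj (d j) * of_real (f (x i - x j))) = \<dots>" .
  show ?thesis
  \<comment> \<open>The merged coefficients may all cancel. Strict positivity then says nothing, but
    the form is 0; this is why the conclusion is not strict.\<close>
  proof (cases "\<exists>y\<in>x ` I. c y \<noteq> 0")
    case True
    then have "finite (x ` I) \<and> (\<exists>y\<in>x ` I. c y \<noteq> 0)" using I by auto
    then show ?thesis
      unfolding eq using f[unfolded strictly_positive_definite_def, rule_format, of "x ` I" c] by simp
  next
    case False
    then have "(\<Sum>y\<in>x ` I. \<Sum>z\<in>x ` I. c y * cnj (c z) * of_real (f (y - z))) = 0"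
      by (intro sum.neutral ballI) auto
    then show ?thesis unfolding eq by simp
  qed
qed

text \<open>With the points 0 and \<open>x\<close> and coefficients 1 and \<open>\<i>\<close>, the
  imaginary part of the form is \<open>f x - f (- x)\<close>, and the form is required to be
  real.\<close>

lemma strictly_positive_definite_even:
  assumes f: "strictly_positive_definite f"
  shows "f (- x) = f x"
proof (cases "x = 0")
  case False
  define c :: "'a \<Rightarrow> complex" where "c y = (if y = 0 then 1 else \<i>)" for y
  have "(\<Sum>y\<in>{0, x}. \<Sum>z\<in>{0, x}. c y * cnj (c z) * of_real (f (y - z))) \<in> \<real>"
    by (rule conjunct1[OF f[unfolded strictly_positive_definite_def, rule_format]])
       (auto simp: c_def)
  then show ?thesis
    using False by (auto simp: c_def complex_is_Real_iff)
qed simp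

text \<open>Without continuity, the value of \<open>f\<close> at 0 is unrelated to integrals of
  \<open>f\<close>. On the diagonal it enters with weight \<open>n\<close> only, against
  \<open>n * (n - 1)\<close> for the integral, so it disappears as \<open>n\<close> grows. Random
  points turn pointwise values of the form into integrals.\<close>

lemma strictly_positive_definite_gauss_integral_nonneg:
  fixes f :: "real \<Rightarrow> real"
  assumes f: "strictly_positive_definite f" and [measurable]: "f \<in> borel_measurable borel"
    and int: "integrable lborel f" and s: "0 < s"
  shows "0 \<le> (\<integral>u. normal_density 0 s u * (f u * cos (\<theta> * u)) \<partial>lborel)"
proof -
  \<comment> \<open>Chosen so that the difference of two independent centred Gaussians of standard
    deviation \<open>\<sigma>\<close> has standard deviation \<open>s\<close>.\<close>
  define \<sigma> where "\<sigma> = s / sqrt 2"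
  have \<sigma>: "0 < \<sigma>" "sqrt (\<sigma>\<^sup>2 + \<sigma>\<^sup>2) = s"
    using s by (auto simp: \<sigma>_def power_divide real_sqrt_divide)
  define F where "F u = f u * cos (\<theta> * u)" for u
  have [measurable]: "F \<in> borel_measurable borel" unfolding F_def by measurable
  define J where "J = (\<integral>u. normal_density 0 s u * F u \<partial>lborel)"
  have F_int: "integrable lborel (\<lambda>u. normal_density 0 s u * F u)"
  proof (rule Bochner_Integration.integrable_bound)
    \<comment> \<open>The constant is the maximum of the Gaussian density, attained at 0.\<close>
    show "integrable lborel (\<lambda>u. (1 / sqrt (2 * pi * s\<^sup>2)) * f u)"
      using int by simp
    have "\<bar>normal_density 0 s u\<bar> \<le> 1 / sqrt (2 * pi * s\<^sup>2)" for u
      using s by (auto simp: normal_density_def divide_right_mono)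
    moreover have "\<bar>F u\<bar> \<le> \<bar>f u\<bar>" for u
      by (simp add: F_def abs_mult mult_left_le)
    ultimately have "\<bar>normal_density 0 s u\<bar> * \<bar>F u\<bar> \<le> 1 / sqrt (2 * pi * s\<^sup>2) * \<bar>f u\<bar>" for u
      by (intro mult_mono) auto
    then show "AE u in lborel. norm (normal_density 0 s u * F u) \<le> norm ((1 / sqrt (2 * pi * s\<^sup>2)) * f u)"
      by (intro AE_I2) (simp only: real_norm_def abs_mult, simp)
  qed simp
  let ?N = "density lborel (normal_density 0 \<sigma>) :: real measure"
  have bound: "0 \<le> real n * F 0 + real n * (real n - 1) * J" for n
  proof -
    let ?P = "PiM {..<n} (\<lambda>_. ?N)"
    have N: "prob_space ?N" by (rule prob_space_normal_density) (rule \<sigma>)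
    interpret N: prob_space ?N by (rule N)
    interpret P: prob_space ?P by (rule prob_space_PiM) (rule N)
    have comp: "distr ?P borel (\<lambda>\<omega>. \<omega> i) = ?N" if "i < n" for i
    proof -
      have "distr ?P borel (\<lambda>\<omega>. \<omega> i) = distr ?P ?N (\<lambda>\<omega>. \<omega> i)"
        by (rule distr_cong) auto
      then show ?thesis
        using distr_PiM_component[of "{..<n}" "\<lambda>_. ?N" i] N that by simp
    qed
    have meas[measurable]: "(\<lambda>\<omega>. \<omega> i) \<in> borel_measurable ?P" if "i < n" for i
      using measurable_component_singleton[of i "{..<n}" "\<lambda>_. ?N"] that by simp
    have dist: "distributed ?P lborel (\<lambda>\<omega>. \<omega> i) (normal_density 0 \<sigma>)" if "i < n" for i
    proof -
      have "distr ?P lborel (\<lambda>\<omega>. \<omega> i) = distr ?P borel (\<lambda>\<omega>. \<omega> i)"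
        by (rule distr_cong) auto
      then show ?thesis
        using comp[OF that] meas[OF that] by (simp add: distributed_def)
    qed
    have indep: "P.indep_var borel (\<lambda>\<omega>. \<omega> i) borel (\<lambda>\<omega>. \<omega> j)" if "i < n" "j < n" "i \<noteq> j" for i j
    proof -
      \<comment> \<open>Independence means that the joint law is the product of the marginals.
        Restriction to \<open>{..<n}\<close> is the identity on the product space, so the joint law
        is \<open>?P\<close> itself.\<close>
      have "P.indep_vars (\<lambda>_. ?N) (\<lambda>i \<omega>. \<omega> i) {..<n}"
      proof (subst P.indep_vars_iff_distr_eq_PiM')
        have "distr ?P ?P (\<lambda>x. \<lambda>i\<in>{..<n}. x i) = distr ?P ?P (\<lambda>x. x)"
          by (rule distr_cong) (auto simp: space_PiM)
        also have "\<dots> = ?P" by (simp add: distr_id)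
        also have "\<dots> = PiM {..<n} (\<lambda>i. distr ?P ?N (\<lambda>\<omega>. \<omega> i))"
          by (intro PiM_cong distr_PiM_component[OF N, symmetric] refl)
        finally show "distr ?P ?P (\<lambda>x. \<lambda>i\<in>{..<n}. x i) = PiM {..<n} (\<lambda>i. distr ?P ?N (\<lambda>\<omega>. \<omega> i))" .
      qed (use that in auto)
      \<comment> \<open>Restricting to singleton index sets gives independent function-valued
        variables; evaluation at \<open>i\<close> and \<open>j\<close> turns them into real
        ones.\<close>
      from P.indep_var_restrict[OF this, of "{i}" "{j}"] that
      have "P.indep_var (PiM {i} (\<lambda>_. ?N)) (\<lambda>\<omega>. \<lambda>k\<in>{i}. \<omega> k) (PiM {j} (\<lambda>_. ?N)) (\<lambda>\<omega>. \<lambda>k\<in>{j}. \<omega> k)"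
        by auto
      then have "P.indep_var borel ((\<lambda>\<omega>. \<omega> i) \<circ> (\<lambda>\<omega>. \<lambda>k\<in>{i}. \<omega> k)) borel ((\<lambda>\<omega>. \<omega> j) \<circ> (\<lambda>\<omega>. \<lambda>k\<in>{j}. \<omega> k))"
        using measurable_component_singleton[of i "{i}" "\<lambda>_. ?N"] measurable_component_singleton[of j "{j}" "\<lambda>_. ?N"]
        by (intro P.indep_var_compose) auto
      then show ?thesis by (simp add: comp_def)
    qed
    have diff: "distributed ?P lborel (\<lambda>\<omega>. \<omega> i - \<omega> j) (normal_density 0 s)"
      if "i < n" "j < n" "i \<noteq> j" for i j
      using P.diff_indep_normal[OF indep[OF that] \<sigma>(1) \<sigma>(1) dist[OF that(1)] dist[OF that(2)]] \<sigma>(2)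
      by simp
    have E_int: "integrable ?P (\<lambda>\<omega>. F (\<omega> i - \<omega> j))" if "i < n" "j < n" for i j
      using distributed_integrable[OF diff[OF that], of F] F_int by (cases "i = j") auto
    have E_eq: "(\<integral>\<omega>. F (\<omega> i - \<omega> j) \<partial>?P) = (if i = j then F 0 else J)" if "i < n" "j < n" for i j
      using distributed_integral[OF diff[OF that], of F] P.prob_space by (auto simp: J_def)
    have "0 \<le> (\<Sum>i<n. \<Sum>j<n. F (\<omega> i - \<omega> j))" for \<omega> :: "nat \<Rightarrow> real"
    proof -
      \<comment> \<open>The coefficients \<open>iexp (\<theta> * x)\<close> twist the form by a
        character, so the real part of the form of \<open>f\<close> becomes the double sum of
        \<open>F\<close>.\<close>
      have "Re (iexp (\<theta> * x) * cnj (iexp (\<theta> * y)) * of_real (f (x - y))) = F (x - y)" for x y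
      proof -
        have "iexp (\<theta> * x) * cnj (iexp (\<theta> * y)) = iexp (\<theta> * (x - y))"
          by (simp add: exp_cnj exp_add[symmetric] algebra_simps)
        then show ?thesis by (simp add: F_def Re_exp mult.commute)
      qed
      then show ?thesis
        using strictly_positive_definite_sum_nonneg[OF f, of "{..<n}" "\<lambda>i. iexp (\<theta> * \<omega> i)" \<omega>]
        by simp
    qed
    then have "0 \<le> (\<integral>\<omega>. (\<Sum>i<n. \<Sum>j<n. F (\<omega> i - \<omega> j)) \<partial>?P)"
      by (intro Bochner_Integration.integral_nonneg)
    also have "\<dots> = (\<Sum>i<n. \<integral>\<omega>. (\<Sum>j<n. F (\<omega> i - \<omega> j)) \<partial>?P)"
      by (intro Bochner_Integration.integral_sum Bochner_Integration.integrable_sum E_int) auto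
    also have "\<dots> = (\<Sum>i<n. \<Sum>j<n. \<integral>\<omega>. F (\<omega> i - \<omega> j) \<partial>?P)"
      by (intro sum.cong refl Bochner_Integration.integral_sum E_int) auto
    also have "\<dots> = (\<Sum>i<n. \<Sum>j<n. if i = j then F 0 else J)"
      by (intro sum.cong refl E_eq) auto
    also have "\<dots> = (\<Sum>i<n. \<Sum>j<n. J + (if i = j then F 0 - J else 0))"
      by (intro sum.cong) auto
    also have "\<dots> = real n * F 0 + real n * (real n - 1) * J"
      by (simp add: sum.distrib algebra_simps)
    finally show ?thesis .
  qed
  \<comment> \<open>Taking \<open>n + 2\<close> points makes both factors \<open>n + 2\<close> and
    \<open>n + 1\<close> positive, so that they can be divided out.\<close>
  have "0 \<le> F 0 / real (Suc n) + J" for n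
  proof -
    have "0 \<le> real (n + 2) * (F 0 + real (Suc n) * J)"
      using bound[of "n + 2"] by (simp add: algebra_simps)
    then have "0 \<le> F 0 + real (Suc n) * J"
      by (simp only: zero_le_mult_iff) auto
    then have "0 \<le> (F 0 + real (Suc n) * J) / real (Suc n)" by simp
    then show ?thesis by (simp add: add_divide_distrib del: of_nat_Suc)
  qed
  moreover have "(\<lambda>n. F 0 / real (Suc n) + J) \<longlonglongrightarrow> 0 + J"
    by (intro tendsto_intros LIMSEQ_Suc lim_const_over_n)
  ultimately have "0 \<le> 0 + J"
    by (intro LIMSEQ_le_const) auto
  then show ?thesis by (simp add: J_def F_def)
qed

lemma strictly_positive_definite_cos_integral_nonneg:
  fixes f :: "real \<Rightarrow> real"
  assumes f: "strictly_positive_definite f" and [measurable]: "f \<in> borel_measurable borel"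
    and int: "integrable lborel f"
  shows "0 \<le> (\<integral>u. f u * cos (\<theta> * u) \<partial>lborel)"
proof (rule LIMSEQ_le_const)
  \<comment> \<open>The Gaussian weight without its normalising constant: it is at most 1 and tends
    to 1 pointwise, so \<open>norm (f u)\<close> dominates. \<open>Suc n\<close> keeps the standard
    deviation positive.\<close>
  let ?g = "\<lambda>n u. exp (- u\<^sup>2 / (2 * (real (Suc n))\<^sup>2)) * (f u * cos (\<theta> * u))"
  show "(\<lambda>n. \<integral>u. ?g n u \<partial>lborel) \<longlonglongrightarrow> (\<integral>u. f u * cos (\<theta> * u) \<partial>lborel)"
  proof (rule integral_dominated_convergence[where w="\<lambda>u. norm (f u)"])
    show "AE u in lborel. (\<lambda>n. ?g n u) \<longlonglongrightarrow> f u * cos (\<theta> * u)"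
    proof (rule AE_I2)
      fix u :: real
      have "(\<lambda>n. exp (- u\<^sup>2 / (2 * (real (Suc n))\<^sup>2))) \<longlonglongrightarrow> exp 0"
        by (intro tendsto_exp tendsto_divide_0[OF tendsto_const] filterlim_at_top_imp_at_infinity
            filterlim_tendsto_pos_mult_at_top[OF tendsto_const] filterlim_pow_at_top
            filterlim_compose[OF filterlim_real_sequentially filterlim_Suc]) auto
      from tendsto_mult_right[OF this] show "(\<lambda>n. ?g n u) \<longlonglongrightarrow> f u * cos (\<theta> * u)" by simp
    qed
    have "\<bar>exp (- u\<^sup>2 / (2 * (real (Suc n))\<^sup>2)) * cos (\<theta> * u)\<bar> \<le> 1" for n u
      by (auto simp: abs_mult simp del: of_nat_Suc intro!: mult_le_one)
    then show "AE u in lborel. norm (?g n u) \<le> norm (f u)" for n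
      by (intro AE_I2) (auto simp: abs_mult mult.left_commute simp del: of_nat_Suc intro!: mult_left_le)
  qed (use int in auto)
  have pos: "0 \<le> x" if "0 \<le> c * x" "0 < c" for c x :: real
    using that by (simp add: zero_le_mult_iff)
  have "0 \<le> (\<integral>u. ?g n u \<partial>lborel)" for n
  proof -
    have "normal_density 0 (real (Suc n)) u * (f u * cos (\<theta> * u)) =
        1 / sqrt (2 * pi * (real (Suc n))\<^sup>2) * ?g n u" for u
      by (simp add: normal_density_def)
    then have "0 \<le> 1 / sqrt (2 * pi * (real (Suc n))\<^sup>2) * (\<integral>u. ?g n u \<partial>lborel)"
      using strictly_positive_definite_gauss_integral_nonneg[OF f _ int, of "real (Suc n)" \<theta>]
      by (simp del: of_nat_Suc)
    then show ?thesis by (rule pos) (simp del: of_nat_Suc)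
  qed
  then show "\<exists>N. \<forall>n\<ge>N. 0 \<le> (\<integral>u. ?g n u \<partial>lborel)" by blast
qed

subsection \<open>Characteristic functions of mixtures\<close>

text \<open>The mixture is the law of a two-stage experiment: a Bernoulli choice of parameter
  \<open>a\<close> followed by a draw from \<open>\<mu>1\<close> or \<open>\<mu>2\<close>. Written
  as a monadic bind, it lets the integral of a bounded function be iterated.\<close>

lemma integral_mixture:
  fixes g :: "real \<Rightarrow> real"
  assumes \<mu>: "real_distribution \<mu>" and \<mu>1: "real_distribution \<mu>1" and \<mu>2: "real_distribution \<mu>2"
    and a: "0 \<le> a" "a \<le> 1"
    and mix: "\<And>B. B \<in> sets borel \<Longrightarrow> measure \<mu> B = a * measure \<mu>1 B + (1 - a) * measure \<mu>2 B"
    and g: "g \<in> borel_measurable borel" "\<And>x. \<bar>g x\<bar> \<le> C"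
  shows "(\<integral>x. g x \<partial>\<mu>) = a * (\<integral>x. g x \<partial>\<mu>1) + (1 - a) * (\<integral>x. g x \<partial>\<mu>2)"
proof -
  interpret \<mu>: real_distribution \<mu> by fact
  interpret \<mu>1: real_distribution \<mu>1 by fact
  interpret \<mu>2: real_distribution \<mu>2 by fact
  define K where "K b = (if b then \<mu>1 else \<mu>2)" for b
  have K[measurable]: "K \<in> measurable (measure_pmf (bernoulli_pmf a)) (subprob_algebra borel)"
    by (auto simp: K_def space_subprob_algebra \<mu>1.subprob_space_axioms \<mu>2.subprob_space_axioms
        intro!: prob_space_imp_subprob_space \<mu>1.prob_space_axioms \<mu>2.prob_space_axioms)
  have "\<mu> = measure_pmf (bernoulli_pmf a) \<bind> K"
  proof (rule measure_eqI)
    show "sets \<mu> = sets (measure_pmf (bernoulli_pmf a) \<bind> K)"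
      by (subst sets_bind[where N=borel]) (auto simp: K_def)
    fix B assume "B \<in> sets \<mu>"
    then have B: "B \<in> sets borel" by simp
    have "emeasure (measure_pmf (bernoulli_pmf a) \<bind> K) B = (\<integral>\<^sup>+b. emeasure (K b) B \<partial>measure_pmf (bernoulli_pmf a))"
      by (rule emeasure_bind[OF _ K B]) simp
    also have "\<dots> = emeasure \<mu>1 B * a + emeasure \<mu>2 B * (1 - a)"
      using a by (simp add: K_def)
    also have "\<dots> = ennreal (measure \<mu> B)"
      using a by (simp add: mix[OF B] \<mu>1.emeasure_eq_measure \<mu>2.emeasure_eq_measure
          ennreal_mult[symmetric] ennreal_plus[symmetric] mult.commute del: ennreal_plus)
    finally show "emeasure \<mu> B = emeasure (measure_pmf (bernoulli_pmf a) \<bind> K) B"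
      by (simp add: \<mu>.emeasure_eq_measure)
  qed
  moreover have "AE b in measure_pmf (bernoulli_pmf a). emeasure (K b) (space (K b)) \<le> ennreal 1"
    by (intro AE_I2) (simp add: K_def \<mu>1.emeasure_space_1 \<mu>2.emeasure_space_1
      del: \<mu>1.space_eq_univ \<mu>2.space_eq_univ)
  ultimately have "(\<integral>x. g x \<partial>\<mu>) = (\<integral>b. \<integral>x. g x \<partial>K b \<partial>measure_pmf (bernoulli_pmf a))"
    using integral_bind[OF g(1) g(2) K, of 1]
    by (simp add: measure_pmf.finite_measure_axioms)
  also have "\<dots> = a * (\<integral>x. g x \<partial>\<mu>1) + (1 - a) * (\<integral>x. g x \<partial>\<mu>2)"
    using a by (simp add: K_def mult.commute)
  finally show ?thesis .
qed

lemma (in real_distribution) integrable_iexp_linear: "integrable M (\<lambda>x. iexp (t * x))"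
  by (rule integrable_const_bound[where B=1]) auto

lemma (in real_distribution) Re_char: "Re (char M t) = (\<integral>x. cos (t * x) \<partial>M)"
  using integral_Re[OF integrable_iexp_linear, of t] by (simp add: char_def Re_exp)

lemma (in real_distribution) Im_char: "Im (char M t) = (\<integral>x. sin (t * x) \<partial>M)"
  using integral_Im[OF integrable_iexp_linear, of t] by (simp add: char_def Im_exp)

lemma char_mixture:
  assumes "real_distribution \<mu>" "real_distribution \<mu>1" "real_distribution \<mu>2"
    and "0 \<le> a" "a \<le> 1"
    and "\<And>B. B \<in> sets borel \<Longrightarrow> measure \<mu> B = a * measure \<mu>1 B + (1 - a) * measure \<mu>2 B"
  shows "char \<mu> t = of_real a * char \<mu>1 t + of_real (1 - a) * char \<mu>2 t"
proof (rule complex_eqI)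
  \<comment> \<open>The bound 1 fits both cosine and sine, which give the real and imaginary
    parts.\<close>
  note mix = integral_mixture[OF assms, where C=1]
  show "Re (char \<mu> t) = Re (of_real a * char \<mu>1 t + of_real (1 - a) * char \<mu>2 t)"
    using mix[of "\<lambda>x. cos (t * x)"] by (simp add: assms(1-3)[THEN real_distribution.Re_char])
  show "Im (char \<mu> t) = Im (of_real a * char \<mu>1 t + of_real (1 - a) * char \<mu>2 t)"
    using mix[of "\<lambda>x. sin (t * x)"] by (simp add: assms(1-3)[THEN real_distribution.Im_char])
qed

section \<open>Laws composed of an atom at 0 and a strictly positive definite density\<close>

lemma char_return_zero: "char (return borel 0) t = 1"
  by (simp add: char_def integral_return)

lemma real_distribution_return: "real_distribution (return borel x)"
  by (simp add: real_distribution_def real_distribution_axioms_def prob_space_return)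

lemma real_distribution_density:
  assumes [measurable]: "f \<in> borel_measurable borel" and "(\<integral>\<^sup>+x. f x \<partial>lborel) = 1"
  shows "real_distribution (density lborel f)"
  using assms(2)
  by (auto simp: real_distribution_def real_distribution_axioms_def emeasure_density intro!: prob_spaceI)

text \<open>The sine integral changes sign under \<open>x\<close> to \<open>- x\<close> because
  \<open>f\<close> is even, so it vanishes; the cosine integral is nonnegative by the Gaussian
  argument.\<close>

lemma char_strictly_positive_definite_density:
  assumes [measurable]: "f \<in> borel_measurable borel" and f_nonneg: "\<And>x. 0 \<le> f x"
    and f_int: "(\<integral>\<^sup>+x. ennreal (f x) \<partial>lborel) = 1" and f: "strictly_positive_definite f"
  shows "char (density lborel f) t \<in> \<real>" "0 \<le> Re (char (density lborel f) t)"
proof -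
  interpret real_distribution "density lborel f"
    by (rule real_distribution_density) (use f_int in simp_all)
  have int: "integrable lborel f"
    by (rule integrableI_nonneg) (use f_nonneg f_int in auto)
  show "0 \<le> Re (char (density lborel f) t)"
    using strictly_positive_definite_cos_integral_nonneg[OF f _ int, of t]
    by (simp add: Re_char integral_density f_nonneg)
  have "(\<integral>x. f x * sin (t * x) \<partial>lborel) = (\<integral>x. f (- x) * sin (t * (- x)) \<partial>lborel)"
    using lborel_integral_real_affine[of "-1" "\<lambda>x. f x * sin (t * x)" 0] by simp
  also have "\<dots> = - (\<integral>x. f x * sin (t * x) \<partial>lborel)"
    by (simp add: strictly_positive_definite_even[OF f])
  finally have "(\<integral>x. f x * sin (t * x) \<partial>lborel) = 0" by simp
  then show "char (density lborel f) t \<in> \<real>"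
    by (simp add: complex_is_Real_iff Im_char integral_density f_nonneg)
qed

text \<open>Passes from extended to real-valued measures and writes the atom as
  \<open>return borel 0\<close>, the shape that \<open>char_mixture\<close> expects.\<close>

lemma class_D_measure:
  fixes X :: "'b \<Rightarrow> real"
  assumes "class_D M X"
  obtains a f where "0 \<le> a" "a \<le> 1" "f \<in> borel_measurable borel" "\<And>x. 0 \<le> f x"
    "(\<integral>\<^sup>+x. ennreal (f x) \<partial>lborel) = 1" "strictly_positive_definite f"
    "\<And>B. B \<in> sets borel \<Longrightarrow> measure (distr M borel X) B =
      a * measure (return borel 0) B + (1 - a) * measure (density lborel f) B"
proof -
  from assms obtain a and f :: "real \<Rightarrow> real" where
    M: "prob_space M" and X: "X \<in> borel_measurable M"
    and a: "0 \<le> a" "a \<le> 1" and f[measurable]: "f \<in> borel_measurable borel" and f0: "\<And>x. 0 \<le> f x"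
    and f1: "(\<integral>\<^sup>+x. ennreal (f x) \<partial>lborel) = 1" and spd: "strictly_positive_definite f"
    and eq: "\<And>B. B \<in> sets borel \<Longrightarrow> emeasure (distr M borel X) B =
            ennreal a * indicator B 0 + ennreal (1 - a) * emeasure (density lborel f) B"
    unfolding class_D_def by blast
  interpret M: real_distribution "distr M borel X"
    using prob_space.real_distribution_distr[OF M X] .
  interpret D: real_distribution "density lborel f"
    by (rule real_distribution_density) (use f1 in simp_all)
  have "measure (distr M borel X) B =
      a * measure (return borel 0) B + (1 - a) * measure (density lborel f) B"
    if B: "B \<in> sets borel" for B
  proof -
    have "ennreal (measure (distr M borel X) B) =
        ennreal a * ennreal (indicator B 0) + ennreal (1 - a) * ennreal (measure (density lborel f) B)"
      using eq[OF B] by (simp add: M.emeasure_eq_measure D.emeasure_eq_measure ennreal_indicator)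
    also have "\<dots> = ennreal (a * indicator B 0 + (1 - a) * measure (density lborel f) B)"
      using a by (simp add: ennreal_mult ennreal_plus)
    finally have "measure (distr M borel X) B = a * indicator B 0 + (1 - a) * measure (density lborel f) B"
      by (subst (asm) ennreal_inj) (use a in auto)
    then show ?thesis using B by (simp add: measure_return)
  qed
  with a f f0 f1 spd show thesis by (rule that)
qed

text \<open>The atom contributes the constant \<open>a\<close> and the density a nonnegative real,
  by the mixture formula.\<close>

lemma class_D_char:
  fixes X :: "'b \<Rightarrow> real"
  assumes "class_D M X"
  shows "char (distr M borel X) t \<in> \<real>" "0 \<le> Re (char (distr M borel X) t)"
proof -
  from assms obtain a f where a: "0 \<le> a" "a \<le> 1" and f: "f \<in> borel_measurable borel" "\<And>x. 0 \<le> f x"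
    "(\<integral>\<^sup>+x. ennreal (f x) \<partial>lborel) = 1" "strictly_positive_definite f"
    and eq: "\<And>B. B \<in> sets borel \<Longrightarrow> measure (distr M borel X) B =
      a * measure (return borel 0) B + (1 - a) * measure (density lborel f) B"
    by (rule class_D_measure) blast
  have "real_distribution (distr M borel X)"
    using assms prob_space.real_distribution_distr unfolding class_D_def by blast
  moreover have "real_distribution (density lborel f)"
    by (rule real_distribution_density) (use f in auto)
  ultimately have "char (distr M borel X) t = a * char (return borel 0) t + (1 - a) * char (density lborel f) t"
    using char_mixture[OF _ real_distribution_return _ a eq] by simp
  then show "char (distr M borel X) t \<in> \<real>" "0 \<le> Re (char (distr M borel X) t)"
    using a char_strictly_positive_definite_density[OF f, of t]
    by (auto simp: char_return_zero)
qed

section \<open>Absolute continuity and decay for the tail\<close>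

lemma char_absolutely_continuous_tendsto_0:
  assumes \<mu>: "real_distribution \<mu>" and ac: "absolutely_continuous lborel \<mu>"
  shows "(char \<mu> \<longlongrightarrow> 0) at_infinity"
proof -
  interpret \<mu>: real_distribution \<mu> by fact
  obtain g where g[measurable]: "g \<in> borel_measurable lborel" and dens: "density lborel g = \<mu>"
    using sigma_finite_measure.Radon_Nikodym[OF sigma_finite_lborel ac] by auto
  have "(\<integral>\<^sup>+x. g x \<partial>lborel) = 1"
    using \<mu>.emeasure_space_1 by (simp add: dens[symmetric] emeasure_density)
  then have fin: "AE x in lborel. g x \<noteq> \<infinity>"
    by (intro nn_integral_noteq_infinite) auto
  \<comment> \<open>The Radon-Nikodym derivative \<open>g\<close> is extended-valued; total mass 1
    makes it finite almost everywhere, so \<open>h\<close> is an integrable real version of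
    it.\<close>
  define h where "h x = enn2real (g x)" for x
  have [measurable]: "h \<in> borel_measurable borel" unfolding h_def by measurable
  have gh: "AE x in lborel. g x = ennreal (h x)"
    using fin by eventually_elim (auto simp: h_def less_top)
  have \<mu>_eq: "\<mu> = density lborel h"
    unfolding dens[symmetric] by (rule density_cong) (use gh in auto)
  have "(\<integral>\<^sup>+x. ennreal (h x) \<partial>lborel) = (\<integral>\<^sup>+x. g x \<partial>lborel)"
    by (rule nn_integral_cong_AE) (use gh in auto)
  then have "integrable lborel h"
    using \<open>(\<integral>\<^sup>+x. g x \<partial>lborel) = 1\<close> by (intro integrableI_nonneg) (auto simp: h_def)
  then have "((\<lambda>t. \<integral>x. of_real (h x) * iexp (t * x) \<partial>lborel) \<longlongrightarrow> 0) at_infinity"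
    by (intro Riemann_Lebesgue) simp
  moreover have "char \<mu> = (\<lambda>t. \<integral>x. of_real (h x) * iexp (t * x) \<partial>lborel)"
    unfolding \<mu>_eq char_def
    by (rule ext, subst integral_density) (auto simp: h_def scaleR_conv_of_real)
  ultimately show ?thesis by (simp only:)
qed

text \<open>A Lebesgue null set without the point 0 has mass 0 under the law of \<open>X\<close>,
  hence under each nonnegative summand of the mixture, and \<open>1 - p\<close> is positive. The
  point 0 is put back at no cost because \<open>\<nu>\<close> has no mass there.\<close>

lemma class_D_mixture_absolutely_continuous:
  fixes X :: "'b \<Rightarrow> real"
  assumes X: "class_D M X" and \<mu>: "real_distribution \<mu>" "real_distribution \<nu>"
    and p: "0 \<le> p" "p < 1" and \<nu>0: "measure \<nu> {0} = 0"
    and mix: "\<And>B. B \<in> sets borel \<Longrightarrow>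
      measure (distr M borel X) B = p * measure \<mu> B + (1 - p) * measure \<nu> B"
  shows "absolutely_continuous lborel \<nu>"
proof -
  interpret \<nu>: real_distribution \<nu> by fact
  from X obtain a f where a: "0 \<le> a" "a \<le> 1" and f: "f \<in> borel_measurable borel" "\<And>x. 0 \<le> f x"
    "(\<integral>\<^sup>+x. ennreal (f x) \<partial>lborel) = 1" "strictly_positive_definite f"
    and eq: "\<And>B. B \<in> sets borel \<Longrightarrow> measure (distr M borel X) B =
      a * measure (return borel 0) B + (1 - a) * measure (density lborel f) B"
    by (rule class_D_measure) blast
  show ?thesis
    unfolding absolutely_continuous_def
  proof
    fix B :: "real set" assume B: "B \<in> null_sets lborel"
    then have Bs[measurable]: "B \<in> sets borel" by auto
    have "B - {0} \<in> null_sets lborel"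
      using B by (intro null_set_Diff) auto
    moreover have "absolutely_continuous lborel (density lborel f)"
      using f(1) by (intro absolutely_continuousI_density) simp
    ultimately have "emeasure (density lborel f) (B - {0}) = 0"
      unfolding absolutely_continuous_def by (intro null_setsD1) blast
    then have "measure (density lborel f) (B - {0}) = 0"
      by (simp add: measure_def)
    moreover have "measure (return borel 0) (B - {0}) = (0::real)"
      by (simp add: measure_return)
    ultimately have "p * measure \<mu> (B - {0}) + (1 - p) * measure \<nu> (B - {0}) = 0"
      using eq[of "B - {0}"] mix[of "B - {0}"] by simp
    moreover have "0 \<le> p * measure \<mu> (B - {0})" "0 \<le> (1 - p) * measure \<nu> (B - {0})"
      using p by auto
    ultimately have "(1 - p) * measure \<nu> (B - {0}) = 0" by linarith
    then have "measure \<nu> (B - {0}) = 0" using p by simp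
    moreover have "measure \<nu> B \<le> measure \<nu> ((B - {0}) \<union> {0})"
      by (rule \<nu>.finite_measure_mono) auto
    moreover have "measure \<nu> ((B - {0}) \<union> {0}) \<le> measure \<nu> (B - {0}) + measure \<nu> {0}"
      by (rule measure_Un_le) auto
    ultimately have "measure \<nu> B = 0"
      using \<nu>0 measure_nonneg[of \<nu> B] by linarith
    then show "B \<in> null_sets \<nu>"
      by (simp add: null_sets_def \<nu>.emeasure_eq_measure)
  qed
qed

text \<open>The variables live on unrelated probability spaces, the one of \<open>X w\<close>
  varying with \<open>w\<close>, since the mixture concerns laws only. Convergence is in
  \<open>ereal\<close>, so an infinite limit is included.\<close>

theorem proposition1:
  fixes \<theta> p :: real
    and M :: "'a measure" and X_bulk :: "'a \<Rightarrow> real"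
    and N :: "'b measure" and X_tail :: "'b \<Rightarrow> real"
    and Q :: "real \<Rightarrow> 'c measure" and X :: "real \<Rightarrow> 'c \<Rightarrow> real"
  assumes "\<theta> \<noteq> 0"
    and "0 < p" and "p < 1"
    and "prob_space M" and "X_bulk \<in> borel_measurable M"
    and "prob_space N" and "X_tail \<in> borel_measurable N"
    and "\<P>(\<omega> in N. X_tail \<omega> = 0) = 0"
    and "\<And>w. w > 0 \<Longrightarrow> prob_space (Q w)"
    and "\<And>w. w > 0 \<Longrightarrow> X w \<in> borel_measurable (Q w)"
    and "\<And>w B. w > 0 \<Longrightarrow> B \<in> sets borel \<Longrightarrow>
           measure (distr (Q w) borel (X w)) B =
             p * measure (distr M borel X_bulk) B +
             (1 - p) * measure (distr N borel (\<lambda>\<omega>. w * X_tail \<omega>)) B"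
    and "\<And>w. w > 0 \<Longrightarrow> class_D (Q w) (X w)"
  shows "((\<lambda>w. lcf \<theta> (Q w) (X w)) \<longlongrightarrow> lcf \<theta> M X_bulk - ereal (2 * ln p / \<theta>\<^sup>2)) at_top"
proof -
  let ?b = "char (distr M borel X_bulk) \<theta>" and ?\<phi> = "\<lambda>w. char (distr (Q w) borel (X w)) \<theta>"
  note [measurable] = assms(5,7)
  have bulk: "real_distribution (distr M borel X_bulk)"
    using prob_space.real_distribution_distr[OF assms(4,5)] .
  have tail: "real_distribution (distr N borel (\<lambda>\<omega>. w * X_tail \<omega>))" for w
    by (rule prob_space.real_distribution_distr[OF assms(6)]) measurable
  \<comment> \<open>Scaling by \<open>w\<close> moves into the argument of the characteristic
    function, leaving one fixed tail law evaluated at \<open>\<theta> * w\<close>.\<close>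
  have mix: "?\<phi> w = p * ?b + (1 - p) * char (distr N borel X_tail) (\<theta> * w)" if "0 < w" for w
  proof -
    have "char (distr N borel (\<lambda>\<omega>. w * X_tail \<omega>)) \<theta> = char (distr N borel X_tail) (\<theta> * w)"
      by (simp add: char_def integral_distr mult.assoc)
    moreover have "real_distribution (distr (Q w) borel (X w))"
      using prob_space.real_distribution_distr[OF assms(9)[OF that] assms(10)[OF that]] .
    from char_mixture[OF this bulk tail _ _ assms(11)[OF that]]
    have "?\<phi> w = of_real p * ?b + of_real (1 - p) * char (distr N borel (\<lambda>\<omega>. w * X_tail \<omega>)) \<theta>"
      using assms(2,3) by simp
    ultimately show ?thesis by simp
  qed
  have "measure (distr N borel X_tail) {0} = 0"
    using assms(8) by (simp add: measure_distr vimage_def Int_def conj_commute)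
  \<comment> \<open>The instance \<open>w = 1\<close> of the mixture concerns the law of
    \<open>X_tail\<close> itself.\<close>
  then have "absolutely_continuous lborel (distr N borel X_tail)"
    using class_D_mixture_absolutely_continuous[OF assms(12)[of 1] bulk tail[of 1], of p]
      assms(2,3) assms(11)[of 1] by simp
  then have "(char (distr N borel X_tail) \<longlongrightarrow> 0) at_infinity"
    using char_absolutely_continuous_tendsto_0 tail[of 1] by simp
  moreover have "filterlim (\<lambda>w. \<theta> * w) at_infinity at_top"
    using assms(1)
    by (intro tendsto_mult_filterlim_at_infinity[OF tendsto_const] filterlim_at_top_imp_at_infinity filterlim_ident)
  ultimately have "((\<lambda>w. char (distr N borel X_tail) (\<theta> * w)) \<longlongrightarrow> 0) at_top"
    by (rule filterlim_compose)
  then have "((\<lambda>w. p * ?b + (1 - p) * char (distr N borel X_tail) (\<theta> * w)) \<longlongrightarrow> p * ?b) at_top"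
    using tendsto_add[OF tendsto_const tendsto_mult_right_zero] by force
  moreover have ev: "eventually (\<lambda>w::real. 0 < w) at_top" by (rule eventually_gt_at_top)
  ultimately have lim: "(?\<phi> \<longlongrightarrow> p * ?b) at_top"
    by (subst tendsto_cong[OF eventually_mono[OF ev mix]]) simp_all
  have D: "?\<phi> w \<in> \<real>" "0 \<le> Re (?\<phi> w)" if "0 < w" for w
    using class_D_char[OF assms(12)[OF that]] by auto
  \<comment> \<open>Membership in the class is assumed for \<open>X w\<close>, not for
    \<open>X_bulk\<close>. That \<open>?b\<close> is real and nonnegative is inherited from the
    limit of \<open>?\<phi>\<close>.\<close>
  have "Im (p * ?b) = 0"
    using tendsto_unique[OF _ tendsto_Im[OF lim] tendsto_eventually[OF eventually_mono[OF ev]], of 0] D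
    by (auto simp: complex_is_Real_iff)
  then have b_real: "Im ?b = 0" using assms(2) by simp
  have "0 \<le> Re (p * ?b)"
    by (rule tendsto_lowerbound[OF tendsto_Re[OF lim] eventually_mono[OF ev]]) (use D in auto)
  then have b_nonneg: "0 \<le> Re ?b" using assms(2) by (simp add: zero_le_mult_iff)
  have \<theta>2: "0 < 2 / \<theta>\<^sup>2" using assms(1) by simp
  have lim_Re: "((\<lambda>w. Re (?\<phi> w)) \<longlongrightarrow> p * Re ?b) at_top"
    using tendsto_Re[OF lim] by simp
  show ?thesis
  proof (cases "?b = 0")
    case True
    then have lim0: "((\<lambda>w. Re (?\<phi> w)) \<longlongrightarrow> 0) at_top" using lim_Re by simp
    have "((\<lambda>w. lcf \<theta> (Q w) (X w)) \<longlongrightarrow> \<infinity>) at_top"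
      unfolding tendsto_PInfty
    proof
      fix r :: real
      \<comment> \<open>The threshold below which \<open>- (2 / \<theta>\<^sup>2) * ln\<close>
        exceeds \<open>r\<close>.\<close>
      let ?d = "exp (- r * \<theta>\<^sup>2 / 2)"
      from lim0 have "eventually (\<lambda>w. Re (?\<phi> w) < ?d) at_top"
        by (rule order_tendstoD) simp
      with ev show "eventually (\<lambda>w. ereal r < lcf \<theta> (Q w) (X w)) at_top"
      proof eventually_elim
        case (elim w)
        show ?case
        \<comment> \<open>A zero of \<open>?\<phi>\<close> already gives the value
          \<open>\<infinity>\<close>; otherwise real and nonnegative means positive, and the
          logarithm is monotone there.\<close>
        proof (cases "?\<phi> w = 0")
          case False
          then have pos: "0 < Re (?\<phi> w)"
            using D[OF elim(1)] by (auto simp: complex_is_Real_iff complex_eq_iff)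
          have "ln (Re (?\<phi> w)) < - r * \<theta>\<^sup>2 / 2"
            using elim(2) pos by (metis ln_exp ln_less_cancel_iff exp_gt_zero)
          then have "r < - (2 / \<theta>\<^sup>2) * ln (Re (?\<phi> w))"
            using assms(1) by (simp add: field_simps)
          with False show ?thesis by (simp add: lcf_def)
        qed (simp add: lcf_def)
      qed
    qed
    with True show ?thesis by (simp add: lcf_def)
  next
    case False
    then have pos: "0 < Re ?b"
      using b_real b_nonneg by (auto simp: complex_eq_iff)
    \<comment> \<open>A positive limit makes \<open>?\<phi> w\<close> eventually nonzero, so
      \<open>lcf\<close> is eventually given by its logarithmic branch, which is continuous at the
      limit.\<close>
    have "0 < p * Re ?b" using pos assms(2) by simp
    have "((\<lambda>w. ereal (- (2 / \<theta>\<^sup>2) * ln (Re (?\<phi> w)))) \<longlongrightarrow> ereal (- (2 / \<theta>\<^sup>2) * ln (p * Re ?b))) at_top"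
      using \<open>0 < p * Re ?b\<close> by (intro tendsto_intros lim_Re) auto
    moreover have "eventually (\<lambda>w. lcf \<theta> (Q w) (X w) = ereal (- (2 / \<theta>\<^sup>2) * ln (Re (?\<phi> w)))) at_top"
      using order_tendstoD(1)[OF lim_Re \<open>0 < p * Re ?b\<close>]
      by eventually_elim (auto simp: lcf_def)
    moreover have "lcf \<theta> M X_bulk - ereal (2 * ln p / \<theta>\<^sup>2) = ereal (- (2 / \<theta>\<^sup>2) * ln (p * Re ?b))"
      using False pos assms(2) by (simp add: lcf_def ln_mult algebra_simps add_divide_distrib)
    ultimately show ?thesis
      by (simp add: tendsto_cong)
  qed
qed

end
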